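(* Let $r\ge 2$ and $d\ge 1$ be integers and $0<\varepsilon\le 1$ a real number, and let $p_r$ be the probability that a uniformly random permutation of an $r$-element set has at least one fixed point. Let \[ m=\left\lfloor \frac{\ln(\varepsilon)}{\ln(1-p_r)}\right\rfloor+1 . \] Then there is an integer $N_0$ such that for every $N\ge N_0$ the following holds. If $\mathcal{F}=\{F_1,\ldots,F_N\}$ is a family of $N$ pairwise disjoint sets of $r$ points each in $\mathbb{R}^d$, then there exist $m$ colorful partitions $\mathcal{P}_1,\ldots,\mathcal{P}_m$ of $\bigcup\mathcal{F}$ such that for every $\mathcal{G}\subset\mathcal{F}$ with $|\mathcal{G}|\ge\varepsilon|\mathcal{F}|$ there is a $k$ for which the restriction of $\mathcal{P}_k$ to $\bigcup\mathcal{G}$ is a Tverberg partition of $\bigcup\mathcal{G}$ (this restriction is automatically a colorful partition of $\mathcal{G}$). In particular, the smallest number $m_{\mathrm{col}}(\varepsilon,r)$ of colorful partitions with this property satisfies $m_{\mathrm{col}}(\varepsilon,r)\le \left\lfloor \frac{\ln(\varepsilon)}{\ln(1-p_r)}\right\rfloor+1$.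
   Context: Given a family $\mathcal{F}$ of sets of $r$ points each (the "colors"), a colorful partition is a partition of $\bigcup\mathcal{F}$ into $r$ sets $X_1,\ldots,X_r$ with $|F\cap X_j|=1$ for every $F\in\mathcal{F}$ and every $j$. The restriction of a partition $X_1,\ldots,X_r$ to a subset $Y$ is the partition $X_1\cap Y,\ldots,X_r\cap Y$. A partition of a finite set $Y\subset\mathbb{R}^d$ into $r$ sets $Y_1,\dots,Y_r$ is a Tverberg partition if $\bigcap_{j=1}^r\operatorname{conv}(Y_j)\ne\emptyset$. *)

theory Defs
  imports "HOL-Probability.Probability" "HOL-Combinatorics.Permutations"
begin

definition fixpoint_prob :: "nat \<Rightarrow> real" where
  "fixpoint_prob r =
     measure_pmf.prob (pmf_of_set {\<pi>. \<pi> permutes {..<r}}) {\<pi>. \<exists>i<r. \<pi> i = i}"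

text \<open>Partitions into \<open>r\<close> parts are indexed families \<open>X 0, \<dots>, X (r - 1)\<close>; the values
  of \<open>X\<close> at indices \<open>\<ge> r\<close> are irrelevant. A part may be empty.\<close>

definition indexed_partition :: "nat \<Rightarrow> 'a set \<Rightarrow> (nat \<Rightarrow> 'a set) \<Rightarrow> bool" where
  "indexed_partition r Y X \<longleftrightarrow> (\<Union>j<r. X j) = Y \<and> disjoint_family_on X {..<r}"

definition restrict_partition :: "(nat \<Rightarrow> 'a set) \<Rightarrow> 'a set \<Rightarrow> nat \<Rightarrow> 'a set" where
  "restrict_partition X Y = (\<lambda>j. X j \<inter> Y)"

definition colorful_partition :: "nat \<Rightarrow> 'a set set \<Rightarrow> (nat \<Rightarrow> 'a set) \<Rightarrow> bool" where
  "colorful_partition r \<F> X \<longleftrightarrow>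
     indexed_partition r (\<Union>\<F>) X \<and> (\<forall>F\<in>\<F>. \<forall>j<r. card (F \<inter> X j) = 1)"

definition tverberg_partition ::
    "nat \<Rightarrow> 'a::real_vector set \<Rightarrow> (nat \<Rightarrow> 'a set) \<Rightarrow> bool" where
  "tverberg_partition r Y X \<longleftrightarrow>
     finite Y \<and> indexed_partition r Y X \<and> (\<Inter>j<r. convex hull (X j)) \<noteq> {}"

definition color_family :: "nat \<Rightarrow> nat \<Rightarrow> 'a set set \<Rightarrow> bool" where
  "color_family r N \<F> \<longleftrightarrow>
     finite \<F> \<and> card \<F> = N \<and> (\<forall>F\<in>\<F>. finite F \<and> card F = r) \<and> pairwise disjnt \<F>"

definition has_tverberg_cover ::
    "real \<Rightarrow> nat \<Rightarrow> nat \<Rightarrow> 'a::real_vector set set \<Rightarrow> bool" where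
  "has_tverberg_cover \<epsilon> r m \<F> \<longleftrightarrow>
     (\<exists>P :: nat \<Rightarrow> nat \<Rightarrow> 'a set.
        (\<forall>k<m. colorful_partition r \<F> (P k)) \<and>
        (\<forall>\<G>. \<G> \<subseteq> \<F> \<and> real (card \<G>) \<ge> \<epsilon> * real (card \<F>) \<longrightarrow>
           (\<exists>k<m. tverberg_partition r (\<Union>\<G>) (restrict_partition (P k) (\<Union>\<G>)))))"

text \<open>The least \<open>m\<close> such that \<open>m\<close> colorful partitions suffice for all sufficiently large
  families in \<open>d\<close>-space. The first argument only fixes the dimension \<open>d = CARD('d)\<close>.\<close>

definition m_col :: "'d::finite itself \<Rightarrow> real \<Rightarrow> nat \<Rightarrow> nat" where
  "m_col (_ :: 'd itself) \<epsilon> r =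
     (LEAST m. \<exists>N0. \<forall>N\<ge>N0. \<forall>\<F> :: (real ^ 'd) set set.
        color_family r N \<F> \<longrightarrow> has_tverberg_cover \<epsilon> r m \<F>)"

end

theory Submission imports Defs begin

text \<open>
  Order every color \<open>F\<close> and choose \<open>m\<close> independent uniformly random permutations for it; the \<open>k\<close>-th
  permutations of all colors form the \<open>k\<close>-th colorful partition. If the restriction of a partition to
  \<open>\<G>\<close> is not a Tverberg partition, there are affine functions \<open>a\<^sub>0, \<dots>, a\<^sub>r\<^sub>-\<^sub>1\<close> with sum \<open>0\<close> such that
  \<open>a\<^sub>j\<close> is negative on the \<open>j\<close>-th part. Every point then lies in one of the half-spaces \<open>a\<^sub>j \<ge> 0\<close>, while
  no color of \<open>\<G>\<close> has its \<open>j\<close>-th point in the \<open>j\<close>-th half-space for any \<open>j\<close>. For fixed half-spaces a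
  random permutation of a color behaves in this way with probability at most \<open>1 - p\<^sub>r\<close>, the derangements
  being the extremal case. Hence for \<open>m\<close> fixed systems of half-spaces a color fails for all \<open>k\<close> with
  probability at most \<open>(1 - p\<^sub>r)\<^sup>m < \<epsilon>\<close>, and by a Chernoff bound the probability that at least \<open>\<epsilon> N\<close> colors
  fail is exponentially small in \<open>N\<close>. Since half-spaces cut out only polynomially many subsets of the
  \<open>r N\<close> points, a union bound over all systems of half-spaces finishes the proof.
\<close>

section \<open>Polynomial growth against geometric decay\<close>

text \<open>Taking the \<open>K\<close>-th root \<open>\<sigma>\<close> of \<open>\<rho>\<close>
  turns the product into a \<open>K\<close>-th power whose base tends to 0, because
  \<open>n * \<sigma> ^ n\<close> does.\<close>

lemma poly_times_power_tendsto_0: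
  fixes \<rho> c :: real
  assumes "0 < \<rho>" "\<rho> < 1"
  shows "(\<lambda>n. (c * real n + 1) ^ K * \<rho> ^ n) \<longlonglongrightarrow> 0"
proof (cases "K = 0")
  case True
  then show ?thesis using assms by (simp add: LIMSEQ_power_zero)
next
  case False
  define \<sigma> where "\<sigma> = root K \<rho>"
  have \<sigma>: "0 < \<sigma>" "\<sigma> < 1" "\<sigma> ^ K = \<rho>"
    using assms False by (auto simp: \<sigma>_def real_root_gt_zero)
  have "(\<lambda>n. c * (real n * \<sigma> ^ n) + \<sigma> ^ n) \<longlonglongrightarrow> c * 0 + 0"
    using \<sigma> by (intro tendsto_intros powser_times_n_limit_0) auto
  then have "(\<lambda>n. (c * (real n * \<sigma> ^ n) + \<sigma> ^ n) ^ K) \<longlonglongrightarrow> (c * 0 + 0) ^ K"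
    by (rule tendsto_power)
  moreover have "(c * (real n * \<sigma> ^ n) + \<sigma> ^ n) ^ K = (c * real n + 1) ^ K * \<rho> ^ n" for n
  proof -
    have "(c * (real n * \<sigma> ^ n) + \<sigma> ^ n) ^ K = ((c * real n + 1) * \<sigma> ^ n) ^ K"
      by (simp add: algebra_simps)
    also have "\<dots> = (c * real n + 1) ^ K * \<rho> ^ n"
      by (simp add: power_mult_distrib \<sigma>(3)[symmetric] flip: power_mult) (simp add: mult.commute)
    finally show ?thesis .
  qed
  ultimately show ?thesis using False by (simp add: zero_power)
qed

section \<open>Separation of several compact convex sets without a common point\<close>

text \<open>At a minimiser \<open>y\<close> of the sum of squared distances to the sets, the vectors
  from the closest points to \<open>y\<close> sum to 0. They are not all 0, since otherwise
  \<open>y\<close> would be a common point. They serve as the normals \<open>c j\<close>.\<close>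

lemma disjoint_convex_sets_separating_functionals:
  fixes K :: "'i \<Rightarrow> 'a::euclidean_space set"
  assumes "finite J" "J \<noteq> {}"
    and compact: "\<And>j. j \<in> J \<Longrightarrow> compact (K j)" and convex: "\<And>j. j \<in> J \<Longrightarrow> convex (K j)"
    and nonempty: "\<And>j. j \<in> J \<Longrightarrow> K j \<noteq> {}"
    and disj: "(\<Inter>j\<in>J. K j) = {}"
  obtains c b where "\<And>j x. j \<in> J \<Longrightarrow> x \<in> K j \<Longrightarrow> c j \<bullet> x + b j < 0"
    "\<And>x. (\<Sum>j\<in>J. c j \<bullet> x + b j) = 0"
proof -
  have cl: "closed (K j)" if "j \<in> J" for j using compact[OF that] by (rule compact_imp_closed)
  \<comment> \<open>A ball around all the sets is compact, so the minimum over it is attained, and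
    convex, so it contains the mean of the closest points.\<close>
  have "bounded (\<Union>j\<in>J. K j)"
    using \<open>finite J\<close> compact by (simp add: compact_imp_bounded bounded_UN)
  then obtain R where R: "(\<Union>j\<in>J. K j) \<subseteq> cball 0 R"
    using bounded_pos by (metis mem_cball_0 subsetI)
  have ne: "cball 0 R \<noteq> ({} :: 'a set)" using R nonempty \<open>J \<noteq> {}\<close> by blast
  define p where "p y j = closest_point (K j) y" for y j
  have p_in: "p y j \<in> K j" if "j \<in> J" for y j
    using that cl nonempty by (simp add: p_def closest_point_in_set)
  have "continuous_on (cball 0 R) (\<lambda>y. \<Sum>j\<in>J. (dist y (p y j))\<^sup>2)"
    unfolding p_def using cl convex nonempty
    by (intro continuous_intros continuous_on_closest_point) auto
  then obtain y where y: "y \<in> cball 0 R"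
    and y_min: "\<And>z. z \<in> cball 0 R \<Longrightarrow>
      (\<Sum>j\<in>J. (dist y (p y j))\<^sup>2) \<le> (\<Sum>j\<in>J. (dist z (p z j))\<^sup>2)"
    using continuous_attains_inf[OF compact_cball ne] by blast
  define n where "n = real (card J)"
  have n: "n > 0" using assms(1,2) by (simp add: n_def card_gt_0_iff)
  define c where "c j = y - p y j" for j
  define z where "z = (\<Sum>j\<in>J. (1 / n) *\<^sub>R p y j)"
  have z_in: "z \<in> cball 0 R"
    unfolding z_def
  proof (intro convex_sum)
    show "p y j \<in> cball 0 R" if "j \<in> J" for j using R p_in[OF that] that by blast
  qed (use assms(1) n in \<open>auto simp: n_def\<close>)
  \<comment> \<open>Replacing \<open>y\<close> by the mean \<open>z\<close> of its closest points lowers the objective by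
    at least \<open>n * (norm (y - z))\<^sup>2\<close>.\<close>
  have nz: "n *\<^sub>R z = (\<Sum>j\<in>J. p y j)"
    using n by (simp add: z_def scaleR_right.sum)
  have "(\<Sum>j\<in>J. (dist z (p z j))\<^sup>2) \<le> (\<Sum>j\<in>J. (dist z (p y j))\<^sup>2)"
    using p_in cl by (intro sum_mono power_mono) (auto simp: p_def[of z] closest_point_le)
  also have "\<dots> = (\<Sum>j\<in>J. (dist y (p y j))\<^sup>2 - 2 * ((y - z) \<bullet> (y - p y j)) + (norm (y - z))\<^sup>2)"
    by (intro sum.cong refl) (simp add: dist_norm power2_norm_eq_inner inner_diff algebra_simps inner_commute)
  also have "\<dots> = (\<Sum>j\<in>J. (dist y (p y j))\<^sup>2) - 2 * ((y - z) \<bullet> (n *\<^sub>R y - n *\<^sub>R z)) + n * (norm (y - z))\<^sup>2"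
  proof -
    have "(\<Sum>j\<in>J. y - p y j) = n *\<^sub>R y - n *\<^sub>R z"
      using nz by (simp add: sum_subtractf n_def sum_constant_scaleR)
    then have "(\<Sum>j\<in>J. (y - z) \<bullet> (y - p y j)) = (y - z) \<bullet> (n *\<^sub>R y - n *\<^sub>R z)"
      by (simp flip: inner_sum_right)
    then show ?thesis
      by (simp add: sum.distrib sum_subtractf n_def flip: sum_distrib_left)
  qed
  also have "\<dots> = (\<Sum>j\<in>J. (dist y (p y j))\<^sup>2) - n * (norm (y - z))\<^sup>2"
    by (simp add: power2_norm_eq_inner flip: scaleR_diff_right)
  finally have "n * (norm (y - z))\<^sup>2 \<le> 0" using y_min[OF z_in] by linarith
  then have "y = z" using n by (simp add: mult_le_0_iff)
  then have sum_c: "(\<Sum>j\<in>J. c j) = 0"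
    using nz by (simp add: c_def sum_subtractf n_def sum_constant_scaleR)
  define s where "s = (\<Sum>j\<in>J. c j \<bullet> p y j)"
  have "s = (\<Sum>j\<in>J. c j \<bullet> y) - (\<Sum>j\<in>J. (norm (c j))\<^sup>2)"
    unfolding s_def c_def sum_subtractf[symmetric]
    by (intro sum.cong refl) (simp add: power2_norm_eq_inner inner_diff algebra_simps inner_commute)
  also have "(\<Sum>j\<in>J. c j \<bullet> y) = 0"
    using sum_c by (simp flip: inner_sum_left)
  finally have s: "s = - (\<Sum>j\<in>J. (norm (c j))\<^sup>2)" by simp
  have "\<exists>j\<in>J. c j \<noteq> 0"
  proof (rule ccontr)
    assume "\<not> ?thesis"
    then have "p y j = y" if "j \<in> J" for j using that by (auto simp: c_def)
    then have "y \<in> (\<Inter>j\<in>J. K j)" using p_in by (metis INT_I)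
    then show False using disj by simp
  qed
  then have "(\<Sum>j\<in>J. (norm (c j))\<^sup>2) > 0"
    using \<open>finite J\<close> by (auto intro: sum_pos2)
  then have "s < 0" using s by simp
  \<comment> \<open>The hyperplane normal to \<open>c j\<close> through the closest point supports
    \<open>K j\<close>. Adding the negative amount \<open>s / n\<close> makes the inequality strict,
    and the \<open>n\<close> shares are just what makes the constants sum to 0.\<close>
  define b where "b j = s / n - c j \<bullet> p y j" for j
  show thesis
  proof
    fix j x assume jx: "j \<in> J" "x \<in> K j"
    then have "c j \<bullet> (x - p y j) \<le> 0"
      unfolding c_def p_def using convex cl by (intro closest_point_dot) auto
    moreover have "s / n < 0" using \<open>s < 0\<close> n by (simp add: divide_neg_pos)
    ultimately show "c j \<bullet> x + b j < 0" by (simp add: b_def inner_diff)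
  next
    fix x
    have "(\<Sum>j\<in>J. c j \<bullet> x + b j) = (\<Sum>j\<in>J. c j) \<bullet> x + (n * (s / n) - s)"
      by (simp add: b_def sum.distrib sum_subtractf inner_sum_left s_def n_def)
    then show "(\<Sum>j\<in>J. c j \<bullet> x + b j) = 0" using sum_c n by simp
  qed
qed

section \<open>Shattering and the number of half-space sections\<close>

definition shatters :: "'a set set \<Rightarrow> 'a set \<Rightarrow> bool" where
  "shatters \<A> S \<longleftrightarrow> (\<forall>T\<subseteq>S. \<exists>A\<in>\<A>. A \<inter> S = T)"

text \<open>Pajor's strengthening of the Sauer--Shelah lemma.\<close>

lemma card_le_card_shattered:
  assumes "finite X" "\<A> \<subseteq> Pow X"
  shows "card \<A> \<le> card {S. S \<subseteq> X \<and> shatters \<A> S}"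
  using assms
proof (induction X arbitrary: \<A> rule: finite_induct)
  case empty
  show ?case
  proof (cases "\<A> = {}")
    case False
    then have "\<A> = {{}}" using empty by auto
    then have "{S. S \<subseteq> {} \<and> shatters \<A> S} = {{}}" by (auto simp: shatters_def)
    with \<open>\<A> = {{}}\<close> show ?thesis by simp
  qed simp
next
  case (insert x X)
  define \<A>0 where "\<A>0 = {A \<in> \<A>. x \<notin> A}"
  define \<A>1 where "\<A>1 = {A. x \<notin> A \<and> insert x A \<in> \<A>}"
  have sub: "\<A>0 \<subseteq> Pow X" "\<A>1 \<subseteq> Pow X"
    using insert.prems insert.hyps by (auto simp: \<A>0_def \<A>1_def)
  let ?S = "\<lambda>\<B>. {S. S \<subseteq> X \<and> shatters \<B> S}"
  have fin: "finite (?S \<B>)" for \<B> :: "'a set set"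
    by (rule finite_subset[of _ "Pow X"]) (use insert.hyps in auto)
  have "\<A> = \<A>0 \<union> insert x ` \<A>1"
  proof (intro set_eqI iffI)
    fix A assume "A \<in> \<A>"
    then show "A \<in> \<A>0 \<union> insert x ` \<A>1"
      by (cases "x \<in> A") (auto simp: \<A>0_def \<A>1_def image_iff insert_absorb intro!: exI[of _ "A - {x}"])
  qed (auto simp: \<A>0_def \<A>1_def)
  then have "card \<A> \<le> card \<A>0 + card (insert x ` \<A>1)" by (metis card_Un_le)
  also have "card (insert x ` \<A>1) \<le> card \<A>1"
    using sub insert.hyps by (intro card_image_le finite_subset[OF sub(2)]) auto
  also have "card \<A>0 + card \<A>1 \<le> card (?S \<A>0) + card (?S \<A>1)"
    using insert.IH sub by (intro add_mono) auto
  also have "\<dots> = card (?S \<A>0 \<union> ?S \<A>1) + card (?S \<A>0 \<inter> ?S \<A>1)"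
    by (intro card_Un_Int fin)
  \<comment> \<open>A set \<open>S\<close> shattered by both halves is counted twice. Its second
    copy is traded for \<open>insert x S\<close>, which \<open>\<A>\<close> shatters too and which
    is new because it contains \<open>x\<close>.\<close>
  also have "card (?S \<A>0 \<inter> ?S \<A>1) = card (insert x ` (?S \<A>0 \<inter> ?S \<A>1))"
    using insert.hyps by (intro card_image[symmetric] inj_onI) (auto simp: insert_ident subset_iff)
  also have "card (?S \<A>0 \<union> ?S \<A>1) + \<dots> = card ((?S \<A>0 \<union> ?S \<A>1) \<union> insert x ` (?S \<A>0 \<inter> ?S \<A>1))"
    using fin insert.hyps by (intro card_Un_disjoint[symmetric]) auto
  also have "\<dots> \<le> card {S. S \<subseteq> insert x X \<and> shatters \<A> S}"
  proof (rule card_mono)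
    show "finite {S. S \<subseteq> insert x X \<and> shatters \<A> S}"
      by (rule finite_subset[of _ "Pow (insert x X)"]) (use insert.hyps in auto)
    have 0: "shatters \<A> S" if "shatters \<A>0 S" for S
      using that unfolding shatters_def \<A>0_def by blast
    have 1: "shatters \<A> S" if S: "S \<subseteq> X" "shatters \<A>1 S" for S
      unfolding shatters_def
    proof (intro allI impI)
      fix T assume "T \<subseteq> S"
      then obtain A where "A \<in> \<A>1" "A \<inter> S = T" using S(2) unfolding shatters_def by blast
      then show "\<exists>A\<in>\<A>. A \<inter> S = T"
        using S insert.hyps by (intro bexI[of _ "insert x A"]) (auto simp: \<A>1_def)
    qed
    have 2: "shatters \<A> (insert x S)" if S: "shatters \<A>0 S" "shatters \<A>1 S" for S
      unfolding shatters_def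
    proof (intro allI impI)
      fix T assume T: "T \<subseteq> insert x S"
      show "\<exists>A\<in>\<A>. A \<inter> insert x S = T"
      proof (cases "x \<in> T")
        case True
        obtain A where "A \<in> \<A>1" "A \<inter> S = T - {x}"
          using S(2) T unfolding shatters_def by (metis Diff_subset_conv insert_is_Un)
        then show ?thesis
          using True by (intro bexI[of _ "insert x A"]) (auto simp: \<A>1_def)
      next
        case False
        then have "T \<subseteq> S" using T by blast
        then obtain A where "A \<in> \<A>0" "A \<inter> S = T"
          using S(1) unfolding shatters_def by blast
        then show ?thesis
          by (intro bexI[of _ A]) (auto simp: \<A>0_def)
      qed
    qed
    show "?S \<A>0 \<union> ?S \<A>1 \<union> insert x ` (?S \<A>0 \<inter> ?S \<A>1) \<subseteq> {S. S \<subseteq> insert x X \<and> shatters \<A> S}"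
      using 0 1 2 by auto
  qed
  finally show ?case by simp
qed

text \<open>The normal \<open>c\<close> may be 0, so degenerate functionals produced by the
  separation also yield sections.\<close>

definition halfspace_sections :: "'a::euclidean_space set \<Rightarrow> 'a set set" where
  "halfspace_sections X = {{x \<in> X. c \<bullet> x + b \<ge> 0} | c b. True}"

text \<open>By Radon's theorem a larger set has two disjoint subsets with intersecting hulls, and no
  half-space cuts off one of them from the other.\<close>

lemma card_shattered_by_halfspaces:
  fixes X S :: "'a::euclidean_space set"
  assumes "finite S" "shatters (halfspace_sections X) S"
  shows "card S \<le> DIM('a) + 1"
proof (rule ccontr)
  assume "\<not> ?thesis"
  then have "affine_dependent S" using assms(1) by (intro affine_dependent_biggerset) auto
  then obtain M P where MP: "M \<subseteq> S" "P \<subseteq> S" "M \<inter> P = {}" "convex hull M \<inter> convex hull P \<noteq> {}"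
    by (rule Radon)
  obtain c b where cb: "{x \<in> X. c \<bullet> x + b \<ge> 0} \<inter> S = M"
    using assms(2) MP(1) unfolding shatters_def halfspace_sections_def by blast
  \<comment> \<open>Sections consist of points of \<open>X\<close> only. Once \<open>S\<close> is
    known to lie in \<open>X\<close>, a point of \<open>P\<close> outside the section must violate
    the inequality itself.\<close>
  obtain A where "A \<in> halfspace_sections X" "A \<inter> S = S"
    using assms(2) unfolding shatters_def by blast
  then have "S \<subseteq> X" by (auto simp: halfspace_sections_def)
  have "convex hull M \<subseteq> {x. c \<bullet> x \<ge> - b}"
    using cb by (intro hull_minimal convex_halfspace_ge) auto
  moreover have "convex hull P \<subseteq> {x. c \<bullet> x < - b}"
    using cb MP \<open>S \<subseteq> X\<close> by (intro hull_minimal convex_halfspace_lt) fastforce+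
  ultimately show False using MP(4) by fastforce
qed

lemma card_subsets_card_le:
  assumes "finite X"
  shows "card {S. S \<subseteq> X \<and> card S \<le> k} \<le> (card X + 1) ^ k"
proof -
  \<comment> \<open>Every such set is the set of values of a \<open>k\<close>-tuple over \<open>X\<close> with one extra null symbol.\<close>
  let ?L = "{xs. set xs \<subseteq> insert None (Some ` X) \<and> length xs = k}"
  have fin: "finite ?L" using assms by (intro finite_lists_length_eq) auto
  have "{S. S \<subseteq> X \<and> card S \<le> k} \<subseteq> (\<lambda>xs. Option.these (set xs)) ` ?L"
  proof
    fix S assume S: "S \<in> {S. S \<subseteq> X \<and> card S \<le> k}"
    then obtain xs where xs: "set xs = S" "distinct xs"
      using assms finite_distinct_list finite_subset by blast
    then have "length xs \<le> k" using S distinct_card by fastforce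
    then show "S \<in> (\<lambda>xs. Option.these (set xs)) ` ?L"
      using S xs by (intro image_eqI[of _ _ "map Some xs @ replicate (k - length xs) None"])
        (auto simp: Option.these_def image_Un image_image intro: rev_image_eqI)
  qed
  then have "card {S. S \<subseteq> X \<and> card S \<le> k} \<le> card ?L"
    using fin by (rule surj_card_le[rotated])
  also have "\<dots> = (card X + 1) ^ k"
    using assms by (subst card_lists_length_eq) (auto simp: card_insert_if card_image)
  finally show ?thesis .
qed

lemma finite_halfspace_sections: "finite X \<Longrightarrow> finite (halfspace_sections X)"
  by (rule finite_subset[of _ "Pow X"]) (auto simp: halfspace_sections_def)

text \<open>Shattered sets have at most \<open>DIM('a) + 1\<close> points, so Pajor's inequality
  bounds the sections by the number of such small subsets.\<close>

lemma card_halfspace_sections: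
  fixes X :: "'a::euclidean_space set"
  assumes "finite X"
  shows "card (halfspace_sections X) \<le> (card X + 1) ^ (DIM('a) + 1)"
proof -
  have "card (halfspace_sections X) \<le> card {S. S \<subseteq> X \<and> shatters (halfspace_sections X) S}"
    using assms by (intro card_le_card_shattered) (auto simp: halfspace_sections_def)
  also have "\<dots> \<le> card {S. S \<subseteq> X \<and> card S \<le> DIM('a) + 1}"
    using assms by (intro card_mono) (auto dest!: card_shattered_by_halfspaces[rotated] intro: finite_subset)
  also have "\<dots> \<le> (card X + 1) ^ (DIM('a) + 1)"
    using assms by (rule card_subsets_card_le)
  finally show ?thesis .
qed

section \<open>Permutations avoiding one cell per row\<close>

definition derangement_count :: "nat \<Rightarrow> nat" where
  "derangement_count r = card {\<pi>. \<pi> permutes {..<r} \<and> (\<forall>i<r. \<pi> i \<noteq> i)}"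

lemma finite_permutations_Collect: "finite {\<pi>. \<pi> permutes {..<r::nat} \<and> Q \<pi>}"
  by (rule finite_subset[OF _ finite_permutations[of "{..<r}"]]) auto

text \<open>Each row \<open>i\<close> has one forbidden cell, in column \<open>g i\<close>. If
  \<open>g\<close> is injective, relabelling the columns gives derangements. Otherwise moving a cell
  from a doubly used column to a free one enlarges the image of \<open>g\<close> without decreasing
  the count.\<close>

lemma card_permutations_avoiding_le:
  assumes "g ` {..<r} \<subseteq> {..<r}"
  shows "card {\<pi>. \<pi> permutes {..<r} \<and> (\<forall>i<r. \<pi> (g i) \<noteq> i)} \<le> derangement_count r"
  using assms
proof (induction "r - card (g ` {..<r})" arbitrary: g rule: less_induct)
  case less
  let ?B = "\<lambda>g. {\<pi>. \<pi> permutes {..<r} \<and> (\<forall>i<r. \<pi> (g i) \<noteq> i)}"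
  show ?case
  proof (cases "inj_on g {..<r}")
    case True
    define h where "h i = (if i < r then g i else i)" for i
    have "g ` {..<r} = {..<r}"
      using True less.prems by (simp add: endo_inj_surj)
    then have "bij_betw h {..<r} {..<r}"
      using True by (auto simp: bij_betw_def h_def inj_on_def)
    then have h: "h permutes {..<r}"
      by (intro bij_imp_permutes) (auto simp: h_def)
    have "(\<lambda>\<pi>. \<pi> \<circ> h) ` ?B g \<subseteq> {\<pi>. \<pi> permutes {..<r} \<and> (\<forall>i<r. \<pi> i \<noteq> i)}"
      using permutes_compose[OF h] by (auto simp: h_def)
    moreover have "inj_on (\<lambda>\<pi>. \<pi> \<circ> h) (?B g)"
    proof (rule inj_onI)
      fix \<pi> \<sigma> assume "\<pi> \<circ> h = \<sigma> \<circ> h"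
      then have "\<pi> (h (inv h x)) = \<sigma> (h (inv h x))" for x by (metis comp_apply)
      then show "\<pi> = \<sigma>" by (simp add: permutes_inverses[OF h] fun_eq_iff)
    qed
    ultimately show ?thesis
      unfolding derangement_count_def by (intro card_inj_on_le finite_permutations_Collect)
  next
    case False
    then obtain i1 i2 where i12: "i1 < r" "i2 < r" "i1 \<noteq> i2" "g i1 = g i2"
      by (auto simp: inj_on_def)
    have "card (g ` {..<r}) < r"
      using False card_image_le[of "{..<r}" g] eq_card_imp_inj_on[of "{..<r}" g] by fastforce
    then have "g ` {..<r} \<noteq> {..<r}" by auto
    then obtain b where b: "b < r" "b \<notin> g ` {..<r}" using less.prems by blast
    define a where "a = g i1"
    define g' where "g' = g(i1 := b)"
    have a: "a < r" "a \<noteq> b" using i12 b less.prems by (auto simp: a_def)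
    \<comment> \<open>The column \<open>a\<close> stays in the image because row \<open>i2\<close>
      still uses it, so the image gains \<open>b\<close> and loses nothing.\<close>
    have "insert b (g ` {..<r}) \<subseteq> g' ` {..<r}"
    proof
      fix v assume "v \<in> insert b (g ` {..<r})"
      then consider "v = b" | i where "i < r" "v = g i" by blast
      then show "v \<in> g' ` {..<r}"
      proof cases
        case 1
        then show ?thesis using i12 by (auto simp: g'_def)
      next
        case 2
        then show ?thesis
          using i12 by (cases "i = i1") (auto simp: g'_def image_iff intro: bexI[of _ i2] bexI[of _ i])
      qed
    qed
    then have "card (insert b (g ` {..<r})) \<le> card (g' ` {..<r})" by (intro card_mono) auto
    then have "card (g ` {..<r}) < card (g' ` {..<r})" using b by simp
    moreover have g': "g' ` {..<r} \<subseteq> {..<r}" using less.prems b by (auto simp: g'_def)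
    ultimately have IH: "card (?B g') \<le> derangement_count r"
      using \<open>card (g ` {..<r}) < r\<close> by (intro less.hyps) auto
    \<comment> \<open>Exchanging the values at \<open>a\<close> and \<open>b\<close> where needed moves the forbidden cell of row \<open>i1\<close> from column
      \<open>a\<close> to the free column \<open>b\<close>; the exchanged permutations are recognised by their value \<open>i1\<close> at \<open>a\<close>.\<close>
    define \<phi> where "\<phi> \<pi> = (if \<pi> b = i1 then \<pi> \<circ> Transposition.transpose a b else \<pi>)" for \<pi> :: "nat \<Rightarrow> nat"
    have "\<phi> ` ?B g \<subseteq> ?B g'"
    proof
      fix \<pi>' assume "\<pi>' \<in> \<phi> ` ?B g"
      then obtain \<pi> where \<pi>: "\<pi> permutes {..<r}" "\<And>i. i < r \<Longrightarrow> \<pi> (g i) \<noteq> i" "\<pi>' = \<phi> \<pi>" by auto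
      have "\<pi>' permutes {..<r}"
        using \<pi> a b by (auto simp: \<phi>_def intro!: permutes_compose permutes_swap_id)
      moreover have "\<pi>' (g' i) \<noteq> i" if "i < r" for i
      proof (cases "i = i1")
        case True
        then show ?thesis using \<pi>(2)[of i1] \<pi>(3) i12 by (auto simp: \<phi>_def g'_def a_def)
      next
        \<comment> \<open>The exchange matters only for a row \<open>i\<close> with
          \<open>g i = a\<close>, since no \<open>g i\<close> equals \<open>b\<close>; there the new
          value is \<open>i1\<close>, which differs from \<open>i\<close>.\<close>
        case False
        then show ?thesis
          using \<pi>(2)[OF that] \<pi>(3) b that by (auto simp: \<phi>_def g'_def Transposition.transpose_def)
      qed
      ultimately show "\<pi>' \<in> ?B g'" by simp
    qed
    moreover have "inj_on \<phi> (?B g)"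
    proof (rule inj_onI)
      fix \<pi> \<sigma> assume ps: "\<pi> \<in> ?B g" "\<sigma> \<in> ?B g" "\<phi> \<pi> = \<phi> \<sigma>"
      have ne: "\<pi> a \<noteq> i1" "\<sigma> a \<noteq> i1" using ps i12 by (auto simp: a_def)
      have *: "\<phi> \<tau> a = i1 \<longleftrightarrow> \<tau> b = i1" if "\<tau> a \<noteq> i1" for \<tau> using that by (simp add: \<phi>_def)
      have "\<pi> b = i1 \<longleftrightarrow> \<sigma> b = i1" using *[of \<pi>, OF ne(1)] *[of \<sigma>, OF ne(2)] ps(3) by simp
      then show "\<pi> = \<sigma>"
      proof (cases "\<pi> b = i1")
        case True
        then have "\<pi> \<circ> Transposition.transpose a b \<circ> Transposition.transpose a b =
            \<sigma> \<circ> Transposition.transpose a b \<circ> Transposition.transpose a b"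
          using ps(3) \<open>\<pi> b = i1 \<longleftrightarrow> \<sigma> b = i1\<close> by (simp add: \<phi>_def)
        then show ?thesis by (simp add: comp_assoc)
      next
        case False
        then show ?thesis
          using ps(3) \<open>\<pi> b = i1 \<longleftrightarrow> \<sigma> b = i1\<close> by (simp add: \<phi>_def)
      qed
    qed
    ultimately have "card (?B g) \<le> card (?B g')"
      by (intro card_inj_on_le finite_permutations_Collect)
    with IH show ?thesis by simp
  qed
qed

text \<open>The cyclic shift is a derangement and the identity is not. Hence
  \<open>1 - fixpoint_prob r\<close> lies strictly between 0 and 1.\<close>

lemma derangement_count_bounds:
  assumes "r \<ge> 2"
  shows "0 < derangement_count r" "derangement_count r < fact r"
proof -
  have "bij_betw (\<lambda>i. if i < r then (if Suc i = r then 0 else Suc i) else i) {..<r} {..<r}"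
    by (rule bij_betw_byWitness[where f' = "\<lambda>i. if i = 0 then r - 1 else i - 1"]) auto
  then have "(\<lambda>i. if i < r then (if Suc i = r then 0 else Suc i) else i) permutes {..<r}"
    by (intro bij_imp_permutes) auto
  then have "(\<lambda>i. if i < r then (if Suc i = r then 0 else Suc i) else i)
      \<in> {\<pi>. \<pi> permutes {..<r} \<and> (\<forall>i<r. \<pi> i \<noteq> i)}"
    using assms by auto
  then show "0 < derangement_count r"
    unfolding derangement_count_def using finite_permutations_Collect[of r "\<lambda>\<pi>. \<forall>i<r. \<pi> i \<noteq> i"]
    by (subst card_gt_0_iff) blast
  have "{\<pi>. \<pi> permutes {..<r} \<and> (\<forall>i<r. \<pi> i \<noteq> i)} \<subset> {\<pi>. \<pi> permutes {..<r}}"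
  proof
    show "{\<pi>. \<pi> permutes {..<r} \<and> (\<forall>i<r. \<pi> i \<noteq> i)} \<noteq> {\<pi>. \<pi> permutes {..<r}}"
    proof
      assume "{\<pi>. \<pi> permutes {..<r} \<and> (\<forall>i<r. \<pi> i \<noteq> i)} = {\<pi>. \<pi> permutes {..<r}}"
      then have "\<forall>i<r. id i \<noteq> i" using permutes_id[of "{..<r}"] by blast
      then show False using assms by (auto dest: spec[of _ 0])
    qed
  qed auto
  then have "derangement_count r < card {\<pi>. \<pi> permutes {..<r}}"
    unfolding derangement_count_def by (intro psubset_card_mono) (auto simp: finite_permutations)
  then show "derangement_count r < fact r" by (simp add: card_permutations)
qed

lemma one_minus_fixpoint_prob: "1 - fixpoint_prob r = derangement_count r / fact r"
proof -
  let ?S = "{\<pi>. \<pi> permutes {..<r}}"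
  have S: "finite ?S" "?S \<noteq> {}" "card ?S = fact r"
    by (auto simp: finite_permutations card_permutations intro: permutes_id)
  have "1 - fixpoint_prob r =
      measure_pmf.prob (pmf_of_set ?S) (- {\<pi>. \<exists>i<r. \<pi> i = i})"
    unfolding fixpoint_prob_def by (subst measure_pmf.prob_compl[symmetric]) (auto simp: Compl_eq_Diff_UNIV)
  also have "\<dots> = card (?S \<inter> - {\<pi>. \<exists>i<r. \<pi> i = i}) / card ?S"
    using S by (intro measure_pmf_of_set)
  also have "?S \<inter> - {\<pi>. \<exists>i<r. \<pi> i = i} = {\<pi>. \<pi> permutes {..<r} \<and> (\<forall>i<r. \<pi> i \<noteq> i)}"
    by auto
  finally show ?thesis using S by (simp add: derangement_count_def)
qed

section \<open>A Chernoff bound in counting form\<close>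

text \<open>Exponential moments: each coordinate in its bad set gets weight \<open>s\<close>, any
  other weight 1. The total weight factorises over the coordinates, while every function counted
  here has weight at least \<open>s powr (\<epsilon> * card I)\<close>.\<close>

lemma card_PiE_many_in_bad_sets:
  fixes q \<epsilon> :: real
  assumes "finite I" "finite T" and bad: "\<And>i. i \<in> I \<Longrightarrow> B i \<subseteq> T"
    and card_bad: "\<And>i. i \<in> I \<Longrightarrow> card (B i) \<le> q * card T" and q: "0 < q" "q < \<epsilon>"
  shows "card {\<omega> \<in> I \<rightarrow>\<^sub>E T. \<epsilon> * card I \<le> card {i \<in> I. \<omega> i \<in> B i}}
    \<le> (card T * exp (\<epsilon> - q - \<epsilon> * ln (\<epsilon> / q))) ^ card I"
proof -
  \<comment> \<open>This weight minimises the exponent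
    \<open>q * (s - 1) - \<epsilon> * ln s\<close>.\<close>
  define s where "s = \<epsilon> / q"
  have s: "s > 1" using q by (simp add: s_def)
  define M where "M = {\<omega> \<in> I \<rightarrow>\<^sub>E T. \<epsilon> * card I \<le> card {i \<in> I. \<omega> i \<in> B i}}"
  define w where "w i t = (if t \<in> B i then s else 1)" for i t
  have finP: "finite (I \<rightarrow>\<^sub>E T)" using assms by (intro finite_PiE) auto
  have "card M * s powr (\<epsilon> * card I) = (\<Sum>\<omega>\<in>M. s powr (\<epsilon> * card I))" by simp
  also have "\<dots> \<le> (\<Sum>\<omega>\<in>M. \<Prod>i\<in>I. w i (\<omega> i))"
  proof (rule sum_mono)
    fix \<omega> assume "\<omega> \<in> M"
    then have "s powr (\<epsilon> * card I) \<le> s powr card {i \<in> I. \<omega> i \<in> B i}"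
      using s by (intro powr_mono) (auto simp: M_def)
    also have "\<dots> = (\<Prod>i\<in>I. w i (\<omega> i))"
      using s \<open>finite I\<close> by (simp add: w_def powr_realpow prod.If_cases Int_def)
    finally show "s powr (\<epsilon> * card I) \<le> (\<Prod>i\<in>I. w i (\<omega> i))" .
  qed
  also have "\<dots> \<le> (\<Sum>\<omega>\<in>I \<rightarrow>\<^sub>E T. \<Prod>i\<in>I. w i (\<omega> i))"
    using finP s by (intro sum_mono2) (auto simp: M_def w_def intro!: prod_nonneg)
  also have "\<dots> = (\<Prod>i\<in>I. \<Sum>t\<in>T. w i t)"
    using assms by (intro prod_sum_PiE[symmetric]) auto
  also have "\<dots> \<le> (\<Prod>i\<in>I. card T * exp (\<epsilon> - q))"
  proof (intro prod_mono conjI)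
    fix i assume i: "i \<in> I"
    show "0 \<le> (\<Sum>t\<in>T. w i t)" using s by (intro sum_nonneg) (auto simp: w_def)
    have "(\<Sum>t\<in>T. w i t) = (\<Sum>t\<in>T. 1 + (if t \<in> B i then s - 1 else 0))"
      by (intro sum.cong) (auto simp: w_def)
    also have "\<dots> = card T + (s - 1) * card (B i)"
      using \<open>finite T\<close> bad[OF i] by (simp add: sum.distrib sum.If_cases Int_absorb1)
    also have "\<dots> \<le> card T + (s - 1) * (q * card T)"
      using card_bad[OF i] s by (intro add_left_mono mult_left_mono) auto
    also have "\<dots> = card T * (1 + (\<epsilon> - q))"
      using q by (simp add: s_def field_simps)
    also have "\<dots> \<le> card T * exp (\<epsilon> - q)"
      by (intro mult_left_mono exp_ge_add_one_self) auto
    finally show "(\<Sum>t\<in>T. w i t) \<le> card T * exp (\<epsilon> - q)" .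
  qed
  also have "\<dots> = (card T * exp (\<epsilon> - q)) ^ card I" by simp
  finally have *: "card M * s powr (\<epsilon> * card I) \<le> (card T * exp (\<epsilon> - q)) ^ card I" .
  have "s powr (\<epsilon> * card I) = exp (\<epsilon> * ln s) ^ card I"
    using s by (simp add: powr_def exp_of_nat_mult[symmetric] mult_ac)
  then have "card M \<le> (card T * exp (\<epsilon> - q)) ^ card I / exp (\<epsilon> * ln s) ^ card I"
    using * by (simp add: pos_le_divide_eq)
  also have "\<dots> = (card T * exp (\<epsilon> - q - \<epsilon> * ln s)) ^ card I"
    by (simp add: exp_diff flip: power_divide)
  finally show ?thesis unfolding M_def s_def .
qed

text \<open>This is \<open>ln t < t - 1\<close> at \<open>t = q / \<epsilon>\<close>, strict because
  \<open>t\<close> is not 1.\<close>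

lemma chernoff_exponent_neg:
  fixes q \<epsilon> :: real
  assumes "0 < q" "q < \<epsilon>"
  shows "\<epsilon> - q - \<epsilon> * ln (\<epsilon> / q) < 0"
proof -
  have "q / \<epsilon> < 1" "0 < q / \<epsilon>" using assms by auto
  then have "ln (q / \<epsilon>) < q / \<epsilon> - 1"
    using ln_le_minus_one[of "q / \<epsilon>"] ln_eq_minus_one[of "q / \<epsilon>"] by fastforce
  moreover have "ln (\<epsilon> / q) = - ln (q / \<epsilon>)" using assms by (simp add: ln_div)
  ultimately have "ln (\<epsilon> / q) > 1 - q / \<epsilon>" by simp
  then have "\<epsilon> * ln (\<epsilon> / q) > \<epsilon> * (1 - q / \<epsilon>)" using assms by simp
  then show ?thesis using assms by (simp add: algebra_simps)
qed

section \<open>Colorful partitions from permutations, and their restrictions\<close>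

text \<open>The index \<open>\<sigma> F j\<close> names the point of \<open>F\<close> that goes to
  part \<open>j\<close>. Disjointness of the colors keeps different colors from interfering.\<close>

lemma colorful_partition_of_permutations:
  assumes \<F>: "color_family r N \<F>" and e: "\<And>F. F \<in> \<F> \<Longrightarrow> bij_betw (e F) {..<r} F"
    and \<sigma>: "\<And>F. F \<in> \<F> \<Longrightarrow> \<sigma> F permutes {..<r}"
  shows "colorful_partition r \<F> (\<lambda>j. (\<lambda>F. e F (\<sigma> F j)) ` \<F>)"
proof -
  have bij: "bij_betw (\<lambda>j. e F (\<sigma> F j)) {..<r} F" if "F \<in> \<F>" for F
    using bij_betw_trans[OF permutes_imp_bij[OF \<sigma>[OF that]] e[OF that]] by (simp add: comp_def)
  have mem: "e F (\<sigma> F j) \<in> F" if "F \<in> \<F>" "j < r" for F j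
    using bij_betw_apply[OF bij[OF that(1)]] that by blast
  have eq: "F = F'" if "F \<in> \<F>" "F' \<in> \<F>" "x \<in> F" "x \<in> F'" for F F' x
    using \<F> that unfolding color_family_def pairwise_def disjnt_def by blast
  have part: "F \<inter> (\<lambda>F. e F (\<sigma> F j)) ` \<F> = {e F (\<sigma> F j)}" if "F \<in> \<F>" "j < r" for F j
    using that mem eq by blast
  have "(\<Union>j<r. (\<lambda>F. e F (\<sigma> F j)) ` \<F>) = (\<Union>F\<in>\<F>. (\<lambda>j. e F (\<sigma> F j)) ` {..<r})" by blast
  also have "\<dots> = \<Union>\<F>" using bij by (auto simp: bij_betw_def)
  finally have "(\<Union>j<r. (\<lambda>F. e F (\<sigma> F j)) ` \<F>) = \<Union>\<F>" .
  moreover have "disjoint_family_on (\<lambda>j. (\<lambda>F. e F (\<sigma> F j)) ` \<F>) {..<r}"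
    unfolding disjoint_family_on_def
  proof (intro ballI impI equals0I)
    fix j k x assume jk: "j \<in> {..<r}" "k \<in> {..<r}" "j \<noteq> k"
      and "x \<in> (\<lambda>F. e F (\<sigma> F j)) ` \<F> \<inter> (\<lambda>F. e F (\<sigma> F k)) ` \<F>"
    then obtain F F' where F: "F \<in> \<F>" "x = e F (\<sigma> F j)" "F' \<in> \<F>" "x = e F' (\<sigma> F' k)" by blast
    then have "F = F'" using eq mem jk by (metis lessThan_iff)
    then show False using bij_betw_imp_inj_on[OF bij[OF F(1)]] F jk by (auto dest: inj_onD)
  qed
  ultimately show ?thesis
    using part by (simp add: colorful_partition_def indexed_partition_def)
qed

lemma colorful_partition_restrict:
  assumes "colorful_partition r \<F> X" "\<G> \<subseteq> \<F>"
  shows "colorful_partition r \<G> (restrict_partition X (\<Union>\<G>))"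
proof -
  have "F \<inter> (X j \<inter> \<Union>\<G>) = F \<inter> X j" if "F \<in> \<G>" for F j using that by blast
  moreover have "disjoint_family_on (\<lambda>j. X j \<inter> \<Union>\<G>) {..<r}"
    using assms(1) unfolding colorful_partition_def indexed_partition_def disjoint_family_on_def
    by blast
  ultimately show ?thesis
    using assms unfolding colorful_partition_def indexed_partition_def restrict_partition_def
    by auto
qed

section \<open>Half-space covers as witnesses of failure\<close>

text \<open>All of \<open>X\<close> is to be covered, so the range of the union bound depends
  neither on the subfamily nor on the partition. Extensional functions keep it finite.\<close>

definition halfspace_covers :: "nat \<Rightarrow> 'a::euclidean_space set \<Rightarrow> (nat \<Rightarrow> 'a set) set" where
  "halfspace_covers r X = {S \<in> {..<r} \<rightarrow>\<^sub>E halfspace_sections X. X \<subseteq> (\<Union>j<r. S j)}"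

lemma finite_halfspace_covers: "finite X \<Longrightarrow> finite (halfspace_covers r X)"
  unfolding halfspace_covers_def
  by (rule finite_subset[of _ "{..<r} \<rightarrow>\<^sub>E halfspace_sections X"])
    (auto intro!: finite_PiE finite_halfspace_sections)

lemma card_halfspace_covers:
  fixes X :: "'a::euclidean_space set"
  assumes "finite X"
  shows "card (halfspace_covers r X) \<le> (card X + 1) ^ ((DIM('a) + 1) * r)"
proof -
  have "card (halfspace_covers r X) \<le> card ({..<r} \<rightarrow>\<^sub>E halfspace_sections X)"
    unfolding halfspace_covers_def
    using assms by (intro card_mono) (auto intro!: finite_PiE finite_halfspace_sections)
  also have "\<dots> = card (halfspace_sections X) ^ r" by (simp add: card_PiE)
  also have "\<dots> \<le> ((card X + 1) ^ (DIM('a) + 1)) ^ r"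
    using card_halfspace_sections[OF assms] by (rule power_mono) simp
  finally show ?thesis by (simp only: power_mult)
qed

text \<open>The hulls of the parts are compact, nonempty and without a common point, so the
  separation applies; the half-spaces are where its functionals are nonnegative.\<close>

lemma not_tverberg_imp_halfspace_cover:
  fixes X Y :: "'a::euclidean_space set"
  assumes "finite X" "Y \<subseteq> X" "r > 0" "indexed_partition r Y Z" "\<And>j. j < r \<Longrightarrow> Z j \<noteq> {}"
    and "\<not> tverberg_partition r Y Z"
  obtains S where "S \<in> halfspace_covers r X" "\<And>j. j < r \<Longrightarrow> Z j \<inter> S j = {}"
proof -
  have "finite Y" using assms finite_subset by blast
  have Z: "finite (Z j)" if "j < r" for j
    by (rule finite_subset[OF _ \<open>finite Y\<close>]) (use that assms(4) in \<open>auto simp: indexed_partition_def\<close>)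
  have "(\<Inter>j<r. convex hull (Z j)) = {}"
    using assms(4,6) \<open>finite Y\<close> by (simp add: tverberg_partition_def)
  then obtain c b where cb: "\<And>j x. j \<in> {..<r} \<Longrightarrow> x \<in> convex hull (Z j) \<Longrightarrow> c j \<bullet> x + b j < 0"
    "\<And>x. (\<Sum>j<r. c j \<bullet> x + b j) = 0"
    by (rule disjoint_convex_sets_separating_functionals[rotated 5])
      (use assms(3,5) Z in \<open>auto simp: finite_imp_compact_convex_hull\<close>)
  define S where "S = (\<lambda>j\<in>{..<r}. {x \<in> X. c j \<bullet> x + b j \<ge> 0})"
  \<comment> \<open>Numbers with sum 0 cannot all be negative. This holds at every point, hence on
    \<open>X\<close> and not only on \<open>Y\<close>.\<close>
  have "\<exists>j<r. c j \<bullet> x + b j \<ge> 0" for x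
  proof (rule ccontr)
    assume "\<not> ?thesis"
    then have "(\<Sum>j<r. c j \<bullet> x + b j) < (\<Sum>j<r. 0)"
      using assms(3) by (intro sum_strict_mono) auto
    then show False using cb(2) by simp
  qed
  then have "X \<subseteq> (\<Union>j<r. S j)" by (fastforce simp: S_def)
  then have "S \<in> halfspace_covers r X"
    by (auto simp: halfspace_covers_def halfspace_sections_def S_def)
  moreover have "Z j \<inter> S j = {}" if "j < r" for j
    using cb(1)[of j] hull_inc[of _ "Z j" convex] that by (fastforce simp: S_def)
  ultimately show thesis by (rule that)
qed

section \<open>The union bound\<close>

text \<open>The sample space is \<open>\<F> \<rightarrow>\<^sub>E T\<close>: an
  \<open>m\<close>-tuple of permutations for each color. The assumption \<open>small\<close> says
  that the number of systems of half-spaces times the Chernoff bound stays below 1.\<close>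

lemma colorful_partitions_exist:
  fixes \<F> :: "'a::euclidean_space set set" and \<epsilon> :: real and r m :: nat
  defines "q \<equiv> (derangement_count r / fact r) ^ m"
  assumes r: "r \<ge> 2" and \<F>: "color_family r N \<F>" and "N > 0" and "0 < \<epsilon>" and q: "q < \<epsilon>"
    and small: "(real r * N + 1) ^ ((DIM('a) + 1) * r * m) * exp (\<epsilon> - q - \<epsilon> * ln (\<epsilon> / q)) ^ N < 1"
  shows "\<exists>P. (\<forall>k<m. colorful_partition r \<F> (P k)) \<and>
    (\<forall>\<G>. \<G> \<subseteq> \<F> \<and> real (card \<G>) \<ge> \<epsilon> * real (card \<F>) \<longrightarrow>
      (\<exists>k<m. tverberg_partition r (\<Union>\<G>) (restrict_partition (P k) (\<Union>\<G>))))"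
proof -
  have fin: "finite \<F>" "card \<F> = N" and card_r: "\<And>F. F \<in> \<F> \<Longrightarrow> finite F \<and> card F = r"
    using \<F> by (auto simp: color_family_def)
  have "\<exists>e. bij_betw e {..<r} F" if "F \<in> \<F>" for F
    using ex_bij_betw_nat_finite[of F] card_r[OF that] by (auto simp: atLeast0LessThan)
  then obtain e where e: "\<And>F. F \<in> \<F> \<Longrightarrow> bij_betw (e F) {..<r} F" by metis
  define X where "X = \<Union>\<F>"
  have finX: "finite X" using fin card_r by (auto simp: X_def)
  have "card X \<le> (\<Sum>F\<in>\<F>. card F)" unfolding X_def by (rule card_Union_le_sum_card)
  also have "\<dots> = r * N" using card_r fin by (simp add: mult.commute)
  finally have cardX: "card X \<le> r * N" .
  define W where "W = halfspace_covers r X"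
  define T where "T = {..<m} \<rightarrow>\<^sub>E {\<pi>. \<pi> permutes {..<r}}"
  have T: "finite T" "card T = fact r ^ m"
    by (auto simp: T_def card_PiE card_permutations finite_permutations intro!: finite_PiE)
  \<comment> \<open>For one cover, \<open>miss\<close> holds the permutations sending no point of
    \<open>F\<close> into the half-space of its part. \<open>Bad\<close> asks for this at every
    \<open>k\<close>, and \<open>M\<close> collects the choices with too many bad colors.\<close>
  define miss where "miss S F = {\<pi>. \<pi> permutes {..<r} \<and> (\<forall>j<r. e F (\<pi> j) \<notin> S j)}" for S F
  define Bad where "Bad Ss F = (\<Pi>\<^sub>E k\<in>{..<m}. miss (Ss k) F)" for Ss F
  define M where "M Ss = {\<omega> \<in> \<F> \<rightarrow>\<^sub>E T. \<epsilon> * card \<F> \<le> card {F \<in> \<F>. \<omega> F \<in> Bad Ss F}}" for Ss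
  define \<rho> where "\<rho> = exp (\<epsilon> - q - \<epsilon> * ln (\<epsilon> / q))"
  have "0 < q" using derangement_count_bounds[OF r] by (simp add: q_def)

  have card_miss: "card (miss S F) \<le> derangement_count r" if "S \<in> W" "F \<in> \<F>" for S F
  proof -
    have "\<exists>j<r. e F i \<in> S j" if "i < r" for i
    proof -
      have "e F i \<in> X"
        using e[OF \<open>F \<in> \<F>\<close>] that \<open>F \<in> \<F>\<close> by (auto simp: X_def bij_betw_def)
      then show ?thesis using \<open>S \<in> W\<close> by (auto simp: W_def halfspace_covers_def)
    qed
    \<comment> \<open>Pick a half-space \<open>g i\<close> around each point \<open>e F i\<close>.
      If \<open>\<pi> (g i) = i\<close>, that point goes to part \<open>g i\<close> and hits its
      half-space, so \<open>miss\<close> forbids this for all \<open>i\<close>.\<close>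
    then obtain g where g: "\<And>i. i < r \<Longrightarrow> g i < r \<and> e F i \<in> S (g i)" by metis
    have "miss S F \<subseteq> {\<pi>. \<pi> permutes {..<r} \<and> (\<forall>i<r. \<pi> (g i) \<noteq> i)}"
      using g by (fastforce simp: miss_def)
    then have "card (miss S F) \<le> card {\<pi>. \<pi> permutes {..<r} \<and> (\<forall>i<r. \<pi> (g i) \<noteq> i)}"
      by (intro card_mono finite_permutations_Collect)
    also have "\<dots> \<le> derangement_count r"
      using g by (intro card_permutations_avoiding_le) auto
    finally show ?thesis .
  qed

  have card_M: "card (M Ss) \<le> (card T * \<rho>) ^ N" if Ss: "Ss \<in> {..<m} \<rightarrow>\<^sub>E W" for Ss
    unfolding M_def \<rho>_def fin(2)[symmetric]
  proof (rule card_PiE_many_in_bad_sets)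
    fix F assume F: "F \<in> \<F>"
    show "Bad Ss F \<subseteq> T" unfolding Bad_def T_def by (intro PiE_mono) (auto simp: miss_def)
    have "card (Bad Ss F) = (\<Prod>k<m. card (miss (Ss k) F))" by (simp add: Bad_def card_PiE)
    also have "\<dots> \<le> (\<Prod>k<m. derangement_count r)"
      using Ss F card_miss by (intro prod_mono) (auto simp: PiE_iff)
    finally have "real (card (Bad Ss F)) \<le> real (derangement_count r ^ m)"
      unfolding of_nat_le_iff by simp
    then show "card (Bad Ss F) \<le> q * card T" by (simp add: T q_def power_divide)
  qed (use fin T \<open>0 < q\<close> q in auto)

  have finW: "finite ({..<m} \<rightarrow>\<^sub>E W)"
    unfolding W_def using finX by (intro finite_PiE finite_halfspace_covers) auto
  have "real (card ({..<m} \<rightarrow>\<^sub>E W)) = real (card W) ^ m" by (simp add: card_PiE)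
  also have "\<dots> \<le> (real ((card X + 1) ^ ((DIM('a) + 1) * r))) ^ m"
    unfolding W_def using card_halfspace_covers[OF finX] by (intro power_mono) (auto simp del: of_nat_power)
  also have "\<dots> = (real (card X) + 1) ^ ((DIM('a) + 1) * r * m)"
    by (simp only: of_nat_power of_nat_add of_nat_1 power_mult)
  also have "\<dots> \<le> (real r * N + 1) ^ ((DIM('a) + 1) * r * m)"
    using cardX by (intro power_mono) (auto simp flip: of_nat_mult)
  finally have cardW: "card ({..<m} \<rightarrow>\<^sub>E W) \<le> (real r * N + 1) ^ ((DIM('a) + 1) * r * m)" .

  have "card (\<Union>Ss\<in>{..<m} \<rightarrow>\<^sub>E W. M Ss) \<le> (\<Sum>Ss\<in>{..<m} \<rightarrow>\<^sub>E W. card (M Ss))"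
    using finW by (rule card_UN_le)
  then have "real (card (\<Union>Ss\<in>{..<m} \<rightarrow>\<^sub>E W. M Ss)) \<le> (\<Sum>Ss\<in>{..<m} \<rightarrow>\<^sub>E W. real (card (M Ss)))"
    by (simp flip: of_nat_sum)
  also have "\<dots> \<le> (\<Sum>Ss\<in>{..<m} \<rightarrow>\<^sub>E W. (card T * \<rho>) ^ N)"
    using card_M by (rule sum_mono)
  also have "\<dots> = card ({..<m} \<rightarrow>\<^sub>E W) * \<rho> ^ N * card T ^ N"
    by (simp add: power_mult_distrib)
  also have "\<dots> \<le> ((real r * N + 1) ^ ((DIM('a) + 1) * r * m) * \<rho> ^ N) * card T ^ N"
    using cardW by (intro mult_right_mono) (auto simp: \<rho>_def)
  also have "\<dots> < 1 * real (card T ^ N)"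
    using small by (intro mult_strict_right_mono) (auto simp: \<rho>_def T)
  also have "\<dots> = card (\<F> \<rightarrow>\<^sub>E T)" using fin by (simp add: card_PiE)
  finally have "card (\<Union>Ss\<in>{..<m} \<rightarrow>\<^sub>E W. M Ss) < card (\<F> \<rightarrow>\<^sub>E T)" by simp
  \<comment> \<open>Some choice avoids \<open>M Ss\<close> for all systems at once, and therefore
    serves every subfamily.\<close>
  then have "\<not> \<F> \<rightarrow>\<^sub>E T \<subseteq> (\<Union>Ss\<in>{..<m} \<rightarrow>\<^sub>E W. M Ss)"
    using finW fin T by (auto simp: M_def not_le[symmetric] intro!: card_mono finite_PiE finite_UN_I)
  then obtain \<omega> where \<omega>: "\<omega> \<in> \<F> \<rightarrow>\<^sub>E T" "\<And>Ss. Ss \<in> {..<m} \<rightarrow>\<^sub>E W \<Longrightarrow> \<omega> \<notin> M Ss" by blast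
  have perm: "\<omega> F k permutes {..<r}" if "F \<in> \<F>" "k < m" for F k
    using \<omega>(1) that by (auto simp: T_def PiE_iff)

  define P where "P k j = (\<lambda>F. e F (\<omega> F k j)) ` \<F>" for k j
  have P: "colorful_partition r \<F> (P k)" if "k < m" for k
    unfolding P_def using that by (intro colorful_partition_of_permutations[OF \<F>] e perm)
  have "\<exists>k<m. tverberg_partition r (\<Union>\<G>) (restrict_partition (P k) (\<Union>\<G>))"
    if \<G>: "\<G> \<subseteq> \<F>" "real (card \<G>) \<ge> \<epsilon> * real (card \<F>)" for \<G>
  proof (rule ccontr)
    assume no: "\<not> ?thesis"
    \<comment> \<open>A color in \<open>\<G>\<close> makes all parts of the restrictions nonempty,
      as the separation requires.\<close>
    have "\<G> \<noteq> {}" using \<G>(2) \<open>0 < \<epsilon>\<close> \<open>N > 0\<close> fin by (auto simp: mult_le_0_iff)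
    have "\<exists>S\<in>W. \<forall>j<r. restrict_partition (P k) (\<Union>\<G>) j \<inter> S j = {}" if k: "k < m" for k
    proof -
      have cp: "colorful_partition r \<G> (restrict_partition (P k) (\<Union>\<G>))"
        using P[OF k] \<G>(1) by (rule colorful_partition_restrict)
      have "restrict_partition (P k) (\<Union>\<G>) j \<noteq> {}" if "j < r" for j
      proof
        assume empty: "restrict_partition (P k) (\<Union>\<G>) j = {}"
        obtain F where "F \<in> \<G>" using \<open>\<G> \<noteq> {}\<close> by blast
        then have "card (F \<inter> restrict_partition (P k) (\<Union>\<G>) j) = 1"
          using cp that by (simp add: colorful_partition_def)
        then show False using empty by simp
      qed
      moreover have "\<Union>\<G> \<subseteq> X" using \<G>(1) by (auto simp: X_def)
      ultimately show ?thesis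
        using not_tverberg_imp_halfspace_cover[OF finX, of "\<Union>\<G>" r "restrict_partition (P k) (\<Union>\<G>)"]
          cp no k r unfolding W_def colorful_partition_def by (metis gr0I not_numeral_le_zero)
    qed
    then obtain Ss0 where Ss0: "\<And>k. k < m \<Longrightarrow> Ss0 k \<in> W"
      "\<And>k j. k < m \<Longrightarrow> j < r \<Longrightarrow> restrict_partition (P k) (\<Union>\<G>) j \<inter> Ss0 k j = {}"
      by metis
    define Ss where "Ss = (\<lambda>k\<in>{..<m}. Ss0 k)"
    have Ss: "Ss \<in> {..<m} \<rightarrow>\<^sub>E W" using Ss0(1) by (auto simp: Ss_def)
    \<comment> \<open>The half-spaces found for the separate \<open>k\<close> form one system, for
      which all colors of \<open>\<G>\<close> are bad. These are numerous enough to put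
      \<open>\<omega>\<close> into \<open>M Ss\<close>.\<close>
    have "\<omega> F \<in> Bad Ss F" if F: "F \<in> \<G>" for F
    proof -
      have FF: "F \<in> \<F>" using F \<G>(1) by blast
      have "e F (\<omega> F k j) \<notin> Ss k j" if "k < m" "j < r" for k j
      proof -
        have "\<omega> F k j \<in> {..<r}" using permutes_in_image[OF perm[OF FF that(1)]] that by blast
        then have "e F (\<omega> F k j) \<in> F" using bij_betw_apply[OF e[OF FF]] by blast
        then have "e F (\<omega> F k j) \<in> restrict_partition (P k) (\<Union>\<G>) j"
          using F FF by (auto simp: restrict_partition_def P_def)
        then show ?thesis using Ss0(2)[OF that] that by (auto simp: Ss_def)
      qed
      moreover have "\<omega> F \<in> T" using \<omega>(1) FF by auto
      ultimately show ?thesis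
        using perm[OF FF] by (auto simp: Bad_def miss_def T_def PiE_iff)
    qed
    then have "card \<G> \<le> card {F \<in> \<F>. \<omega> F \<in> Bad Ss F}"
      using \<G>(1) fin by (intro card_mono) auto
    then have "\<omega> \<in> M Ss" using \<omega>(1) \<G>(2) by (simp add: M_def)
    then show False using \<omega>(2)[OF Ss] by contradiction
  qed
  then show ?thesis using P by blast
qed

section \<open>The number of partitions and the bound on \<open>m_col\<close>\<close>

theorem theorem4p2:
  fixes r m :: nat and \<epsilon> :: real
  assumes "r \<ge> 2" and "0 < \<epsilon>" and "\<epsilon> \<le> 1"
    and "m = nat (\<lfloor>ln \<epsilon> / ln (1 - fixpoint_prob r)\<rfloor> + 1)"
  shows "(\<exists>N0. \<forall>N\<ge>N0. \<forall>\<F> :: (real ^ 'd::finite) set set.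
            color_family r N \<F> \<longrightarrow>
            (\<exists>P :: nat \<Rightarrow> nat \<Rightarrow> (real ^ 'd) set.
               (\<forall>k<m. colorful_partition r \<F> (P k)) \<and>
               (\<forall>\<G>. \<G> \<subseteq> \<F> \<and> real (card \<G>) \<ge> \<epsilon> * real (card \<F>) \<longrightarrow>
                  (\<forall>k<m. colorful_partition r \<G> (restrict_partition (P k) (\<Union>\<G>))) \<and>
                  (\<exists>k<m. tverberg_partition r (\<Union>\<G>) (restrict_partition (P k) (\<Union>\<G>))))))
       \<and> int (m_col TYPE('d) \<epsilon> r) \<le> \<lfloor>ln \<epsilon> / ln (1 - fixpoint_prob r)\<rfloor> + 1"
proof -
  define u where "u = derangement_count r / fact r"
  have u: "0 < u" "u < 1"
    using derangement_count_bounds[OF assms(1)]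
      of_nat_less_iff[of "derangement_count r" "fact r", where 'a = real]
    by (auto simp: u_def)
  then have lnu: "ln u < 0" by simp
  define x where "x = ln \<epsilon> / ln u"
  have "x \<ge> 0" using assms(2,3) lnu by (simp add: x_def divide_nonpos_neg)
  have m: "m = nat (\<lfloor>x\<rfloor> + 1)"
    using assms(4) by (simp add: x_def u_def one_minus_fixpoint_prob)
  \<comment> \<open>Since \<open>x\<close> is nonnegative, \<open>nat\<close> truncates nothing. The
    added 1 makes \<open>x < m\<close> strict even for integral \<open>x\<close>, which yields the
    strict \<open>u ^ m < \<epsilon>\<close> that the Chernoff bound needs.\<close>
  have int_m: "int m = \<lfloor>x\<rfloor> + 1" using \<open>x \<ge> 0\<close> by (simp add: m)
  then have "x < m" by linarith
  then have "m * ln u < ln \<epsilon>" using lnu by (simp add: x_def neg_divide_less_eq)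
  then have "ln (u ^ m) < ln \<epsilon>" using u by (simp add: ln_realpow)
  then have q: "u ^ m < \<epsilon>" using u assms(2) by simp
  let ?d = "DIM(real ^ 'd)"
  \<comment> \<open>This decay rate per color and the exponent of the polynomial factor do not
    depend on \<open>N\<close>, so the product falls below 1 eventually.\<close>
  define \<rho> where "\<rho> = exp (\<epsilon> - u ^ m - \<epsilon> * ln (\<epsilon> / u ^ m))"
  have "0 < \<rho>" "\<rho> < 1" using chernoff_exponent_neg[OF _ q] u by (auto simp: \<rho>_def)
  then have "(\<lambda>n. (real r * real n + 1) ^ ((?d + 1) * r * m) * \<rho> ^ n) \<longlonglongrightarrow> 0"
    by (rule poly_times_power_tendsto_0)
  then have "\<forall>\<^sub>F n in sequentially. (real r * real n + 1) ^ ((?d + 1) * r * m) * \<rho> ^ n < 1"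
    by (rule order_tendstoD(2)) simp
  then obtain N1 where N1: "\<And>n. n \<ge> N1 \<Longrightarrow> (real r * real n + 1) ^ ((?d + 1) * r * m) * \<rho> ^ n < 1"
    by (auto simp: eventually_sequentially)
  \<comment> \<open>The maximum with 1 provides \<open>N > 0\<close>.\<close>
  have cover: "\<exists>P. (\<forall>k<m. colorful_partition r \<F> (P k)) \<and>
      (\<forall>\<G>. \<G> \<subseteq> \<F> \<and> real (card \<G>) \<ge> \<epsilon> * real (card \<F>) \<longrightarrow>
        (\<exists>k<m. tverberg_partition r (\<Union>\<G>) (restrict_partition (P k) (\<Union>\<G>))))"
    if "N \<ge> max 1 N1" "color_family r N \<F>" for N and \<F> :: "(real ^ 'd) set set"
    using N1[of N] q that assms(1,2) unfolding \<rho>_def u_def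
    by (intro colorful_partitions_exist) auto
  have "\<exists>N0. \<forall>N\<ge>N0. \<forall>\<F> :: (real ^ 'd) set set.
      color_family r N \<F> \<longrightarrow> has_tverberg_cover \<epsilon> r m \<F>"
    unfolding has_tverberg_cover_def
    by (rule exI[of _ "max 1 N1"], intro allI impI, rule cover)
  then have "m_col TYPE('d) \<epsilon> r \<le> m" unfolding m_col_def by (rule Least_le)
  then have m_col_le: "int (m_col TYPE('d) \<epsilon> r) \<le> \<lfloor>ln \<epsilon> / ln (1 - fixpoint_prob r)\<rfloor> + 1"
    using int_m by (simp add: x_def u_def one_minus_fixpoint_prob)
  have "\<exists>P. (\<forall>k<m. colorful_partition r \<F> (P k)) \<and>
      (\<forall>\<G>. \<G> \<subseteq> \<F> \<and> real (card \<G>) \<ge> \<epsilon> * real (card \<F>) \<longrightarrow>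
        (\<forall>k<m. colorful_partition r \<G> (restrict_partition (P k) (\<Union>\<G>))) \<and>
        (\<exists>k<m. tverberg_partition r (\<Union>\<G>) (restrict_partition (P k) (\<Union>\<G>))))"
    if N: "N \<ge> max 1 N1" "color_family r N \<F>" for N and \<F> :: "(real ^ 'd) set set"
  proof -
    obtain P where "\<forall>k<m. colorful_partition r \<F> (P k)"
      "\<forall>\<G>. \<G> \<subseteq> \<F> \<and> real (card \<G>) \<ge> \<epsilon> * real (card \<F>) \<longrightarrow>
        (\<exists>k<m. tverberg_partition r (\<Union>\<G>) (restrict_partition (P k) (\<Union>\<G>)))"
      using cover[OF N] by blast
    then show ?thesis
      by (intro exI[of _ P]) (blast intro: colorful_partition_restrict)
  qed
  then have "\<forall>N\<ge>max 1 N1. \<forall>\<F> :: (real ^ 'd) set set. color_family r N \<F> \<longrightarrow>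
      (\<exists>P. (\<forall>k<m. colorful_partition r \<F> (P k)) \<and>
        (\<forall>\<G>. \<G> \<subseteq> \<F> \<and> real (card \<G>) \<ge> \<epsilon> * real (card \<F>) \<longrightarrow>
          (\<forall>k<m. colorful_partition r \<G> (restrict_partition (P k) (\<Union>\<G>))) \<and>
          (\<exists>k<m. tverberg_partition r (\<Union>\<G>) (restrict_partition (P k) (\<Union>\<G>)))))"
    by (intro allI impI)
  with m_col_le show ?thesis by (intro conjI exI[of _ "max 1 N1"])
qed

end
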